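(* Let $c$, $k$ and $t$ be positive integers with $c\ge 3$ and $k\ge t+2$. Suppose $\mathcal{F}$ and $\mathcal{G}$ are cross $t$-intersecting subfamilies of $U^{[ck]}_{c,k}$ such that $|\mathcal{F}||\mathcal{G}|$ is maximum among all pairs of cross $t$-intersecting subfamilies of $U^{[ck]}_{c,k}$. If $c\ge 3+2\log_2 t$ or $k\ge 2t+2$, then $\mathcal{F}=\mathcal{G}=\{F\in U^{[ck]}_{c,k}: T\subseteq F\}$ for some $T\in U^{[ck]}_{c,t}$.
   Context: For positive integers $c,k,\ell$, $U^{[ck]}_{c,\ell}$ denotes the set of all families consisting of $\ell$ pairwise disjoint $c$-subsets ("blocks") of $[ck]=\{1,\dots,ck\}$; thus $U^{[ck]}_{c,k}$ is the set of $c$-uniform partitions of $[ck]$. Members are regarded as sets of blocks: for such $A,B$, $A\cap B$ is the set of common blocks, $|A\cap B|$ its number, and $A\subseteq B$ means every block of $A$ is a block of $B$. Two families $\mathcal{A}\subseteq U^{[ck]}_{c,\ell}$, $\mathcal{B}\subseteq U^{[ck]}_{c,m}$ are cross $t$-intersecting if $|A\cap B|\ge t$ for all $A\in\mathcal{A}$, $B\in\mathcal{B}$. *)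

theory Defs
  imports Complex_Main
begin

definition block_families :: "'a set \<Rightarrow> nat \<Rightarrow> nat \<Rightarrow> 'a set set set" where
  "block_families X c l =
     {A. finite A \<and> card A = l \<and> (\<forall>b\<in>A. b \<subseteq> X \<and> card b = c) \<and> pairwise disjnt A}"

definition cross_intersecting :: "nat \<Rightarrow> 'a set set \<Rightarrow> 'a set set \<Rightarrow> bool" where
  "cross_intersecting t \<A> \<B> \<longleftrightarrow> (\<forall>A\<in>\<A>. \<forall>B\<in>\<B>. card (A \<inter> B) \<ge> t)"

end

theory Submission
  imports Defs
begin

text \<open>A \<open>t\<close>-cover of a family is a set of disjoint blocks meeting each of its members in at least
  \<open>t\<close> blocks. Let \<open>t + a\<close> and \<open>t + b\<close> be the least sizes of \<open>t\<close>-covers of \<open>\<G>\<close> and \<open>\<F>\<close>, put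
  \<open>m = k - t\<close>, and let \<open>N(j)\<close> be the number of \<open>c\<close>-uniform partitions of \<open>c * j\<close> points.
  Every \<open>F \<in> \<F>\<close> contains \<open>t\<close> blocks of a minimal cover of \<open>\<F>\<close>. A set \<open>S\<close> of \<open>s < t + a\<close> blocks
  contained in \<open>F\<close> is not a cover of \<open>\<G>\<close>, so for some \<open>G \<in> \<G>\<close>, depending only on \<open>S\<close>, \<open>F\<close> has a
  further block in \<open>G\<close>, for which there are at most \<open>k - s\<close> choices. Iterating,
  \<open>|\<F>| \<le> binom(t + b, t) * m! / (m - a)! * N(m - a)\<close>, and symmetrically for \<open>\<G>\<close>. The product of the
  two bounds splits into a factor depending on \<open>a\<close> and one depending on \<open>b\<close>, and each is smaller
  than \<open>N(m)\<close> unless \<open>a = 0\<close>, respectively \<open>b = 0\<close>. Hence in an optimal pair both minimal covers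
  have size \<open>t\<close>, and one more branching step shows that they agree.\<close>

section \<open>Partition counts, weights and covers\<close>

text \<open>For \<open>c \<ge> 1\<close> this is \<open>(c*j)! / ((c!)^j * j!)\<close>; the
  recursion first picks the block of one fixed point.\<close>

fun num_partitions :: "nat \<Rightarrow> nat \<Rightarrow> nat" where
  "num_partitions c 0 = 1"
| "num_partitions c (Suc j) = ((c * Suc j - 1) choose (c - 1)) * num_partitions c j"

text \<open>Dividing by \<open>fact j\<close> absorbs the falling factorial produced by branching:
  \<open>m! / (m - a)! * N(m - a)\<close> becomes
  \<open>fact m * partition_weight c (m - a)\<close>.\<close>

definition partition_weight :: "nat \<Rightarrow> nat \<Rightarrow> real" where
  "partition_weight c j = real (num_partitions c j) / fact j"

text \<open>Disjointness and size of \<open>S\<close> are demanded separately, through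
  \<open>block_families\<close>.\<close>

definition covers :: "nat \<Rightarrow> 'a set set \<Rightarrow> 'a set \<Rightarrow> bool" where
  "covers t \<G> S \<longleftrightarrow> (\<forall>G\<in>\<G>. t \<le> card (S \<inter> G))"

section \<open>Elementary operations on families of disjoint blocks\<close>

lemma block_familiesD:
  assumes "A \<in> block_families X c l"
  shows "finite A" "card A = l" "\<And>b. b \<in> A \<Longrightarrow> b \<subseteq> X" "\<And>b. b \<in> A \<Longrightarrow> card b = c"
    "pairwise disjnt A"
  using assms by (auto simp: block_families_def)

lemma finite_block_families: "finite X \<Longrightarrow> finite (block_families X c l)"
  by (rule finite_subset[of _ "Pow (Pow X)"]) (auto simp: block_families_def)

lemma card_Union_block_family:
  assumes "finite X" and A: "A \<in> block_families X c l"
  shows "card (\<Union>A) = c * l"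
proof -
  have "card (\<Union>A) = sum card A"
    using block_familiesD[OF A] \<open>finite X\<close>
    by (intro card_Union_disjoint) (auto intro: finite_subset)
  also have "\<dots> = c * l"
    using block_familiesD[OF A] by simp
  finally show ?thesis .
qed

lemma Union_block_family:
  assumes "finite X" "card X = c * k" "A \<in> block_families X c k"
  shows "\<Union>A = X"
  using card_Union_block_family[OF assms(1,3)] assms block_familiesD(3)[OF assms(3)]
  by (intro card_subset_eq) auto

lemma card_Diff_Union_block_family:
  assumes "finite X" "card X = c * k" and S: "S \<in> block_families X c s"
  shows "card (X - \<Union>S) = c * (k - s)"
proof -
  have "\<Union>S \<subseteq> X" using block_familiesD(3)[OF S] by blast
  then show ?thesis
    using card_Union_block_family[OF assms(1) S] assms(1,2)
    by (simp add: card_Diff_subset finite_subset diff_mult_distrib2)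
qed

lemma block_families_size_le:
  assumes "finite X" "card X = c * k" "c \<ge> 1" "A \<in> block_families X c l"
  shows "l \<le> k"
proof -
  have "card (\<Union>A) \<le> card X"
    using assms block_familiesD(3)[OF assms(4)] by (intro card_mono) auto
  then show ?thesis
    using card_Union_block_family[OF assms(1,4)] assms by simp
qed

lemma block_families_subset:
  assumes "A \<in> block_families X c l" "B \<subseteq> A"
  shows "B \<in> block_families X c (card B)"
  using block_familiesD[OF assms(1)] assms(2)
  by (auto simp: block_families_def intro: finite_subset pairwise_subset)

lemma block_families_Un:
  assumes S: "S \<in> block_families X c s" and A: "A \<in> block_families (X - \<Union>S) c l" and "c \<ge> 1"
  shows "S \<union> A \<in> block_families X c (s + l)" "S \<inter> A = {}"
proof -
  have cross: "disjnt a b" if "a \<in> S" "b \<in> A" for a b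
    using that block_familiesD(3)[OF A, of b] by (auto simp: disjnt_def)
  \<comment> \<open>A common block would be disjoint from itself, hence empty, which
    \<open>c \<ge> 1\<close> excludes.\<close>
  show *: "S \<inter> A = {}"
    using cross block_familiesD(4)[OF S] \<open>c \<ge> 1\<close> by (fastforce simp: disjnt_def)
  have "pairwise disjnt (S \<union> A)"
    using cross block_familiesD(5)[OF S] block_familiesD(5)[OF A]
    unfolding pairwise_def by (metis Un_iff disjnt_sym)
  then show "S \<union> A \<in> block_families X c (s + l)"
    using block_familiesD[OF S] block_familiesD[OF A] *
    by (auto simp: block_families_def card_Un_disjoint)
qed

lemma block_families_Diff:
  assumes F: "F \<in> block_families X c k" and "S \<subseteq> F"
  shows "F - S \<in> block_families (X - \<Union>S) c (k - card S)"
proof -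
  have "b \<inter> \<Union>S = {}" if "b \<in> F - S" for b
    using that block_familiesD(5)[OF F] \<open>S \<subseteq> F\<close> by (fastforce simp: pairwise_def disjnt_def)
  moreover have "pairwise disjnt (F - S)"
    using block_familiesD(5)[OF F] by (rule pairwise_subset) auto
  ultimately show ?thesis
    using block_familiesD[OF F] \<open>S \<subseteq> F\<close>
    by (fastforce simp: block_families_def card_Diff_subset finite_subset)
qed

section \<open>Counting partitions, and those through given blocks\<close>

lemma bij_betw_block_families_containing:
  assumes S: "S \<in> block_families X c s" and "c \<ge> 1" "s \<le> k"
  shows "bij_betw (\<lambda>A. S \<union> A) (block_families (X - \<Union>S) c (k - s))
           {F \<in> block_families X c k. S \<subseteq> F}"
proof (rule bij_betw_byWitness[where f' = "\<lambda>F. F - S"])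
  show "\<forall>A\<in>block_families (X - \<Union>S) c (k - s). S \<union> A - S = A"
    using block_families_Un(2)[OF S _ \<open>c \<ge> 1\<close>] by blast
  show "(\<lambda>A. S \<union> A) ` block_families (X - \<Union>S) c (k - s) \<subseteq> {F \<in> block_families X c k. S \<subseteq> F}"
    using block_families_Un(1)[OF S _ \<open>c \<ge> 1\<close>] \<open>s \<le> k\<close> by fastforce
  show "(\<lambda>F. F - S) ` {F \<in> block_families X c k. S \<subseteq> F} \<subseteq> block_families (X - \<Union>S) c (k - s)"
    using block_families_Diff[of _ X c k S] block_familiesD(2)[OF S] by auto
qed auto

lemma card_subsets_containing:
  assumes "finite X" "x \<in> X" "c \<ge> 1"
  shows "card {b. b \<subseteq> X \<and> x \<in> b \<and> card b = c} = (card X - 1) choose (c - 1)"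
proof -
  have "bij_betw (insert x) {b. b \<subseteq> X - {x} \<and> card b = c - 1} {b. b \<subseteq> X \<and> x \<in> b \<and> card b = c}"
  proof (rule bij_betw_byWitness[where f' = "\<lambda>b. b - {x}"])
    show "insert x ` {b. b \<subseteq> X - {x} \<and> card b = c - 1} \<subseteq> {b. b \<subseteq> X \<and> x \<in> b \<and> card b = c}"
    proof clarify
      fix b assume b: "b \<subseteq> X - {x}" "card b = c - 1"
      then have "card (insert x b) = Suc (c - 1)"
        using \<open>finite X\<close> finite_subset[of b X] by (subst card_insert_disjoint) auto
      then show "insert x b \<subseteq> X \<and> x \<in> insert x b \<and> card (insert x b) = c"
        using b assms by auto
    qed
  qed (auto simp: card_Diff_singleton)
  from bij_betw_same_card[OF this] show ?thesis
    using assms by (simp add: n_subsets card_Diff_singleton)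
qed

text \<open>Fix a point \<open>x\<close>. Each partition has exactly one block through
  \<open>x\<close>, so the sets \<open>P b\<close> split the partitions, and removing
  \<open>b\<close> leaves a partition of \<open>c * j\<close> points.\<close>

lemma card_block_families:
  assumes "c \<ge> 1" "finite X" "card X = c * j"
  shows "card (block_families X c j) = num_partitions c j"
  using assms(2,3)
proof (induction j arbitrary: X)
  case 0
  have "block_families X c 0 = {{}}"
    by (auto simp: block_families_def)
  then show ?case by simp
next
  case (Suc j)
  from Suc.prems \<open>c \<ge> 1\<close> obtain x where x: "x \<in> X"
    by (metis card.empty equals0I mult_is_0 nat.distinct(1) not_one_le_zero)
  define B where "B = {b. b \<subseteq> X \<and> x \<in> b \<and> card b = c}"
  define P where "P b = {F \<in> block_families X c (Suc j). {b} \<subseteq> F}" for b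
  have finB: "finite B"
    using Suc.prems by (auto simp: B_def)
  have cardP: "card (P b) = num_partitions c j" if "b \<in> B" for b
  proof -
    have b: "b \<subseteq> X" "card b = c"
      using that by (auto simp: B_def)
    then have "{b} \<in> block_families X c 1"
      by (auto simp: block_families_def)
    from bij_betw_same_card[OF bij_betw_block_families_containing[OF this \<open>c \<ge> 1\<close>, of "Suc j"]]
    have "card (P b) = card (block_families (X - b) c j)"
      by (simp add: P_def)
    moreover have "card (X - b) = c * j"
      using b Suc.prems finite_subset[of b X] by (simp add: card_Diff_subset)
    ultimately show ?thesis
      using Suc.IH[of "X - b"] Suc.prems by simp
  qed
  have "block_families X c (Suc j) = (\<Union>b\<in>B. P b)"
  proof -
    have "F \<in> (\<Union>b\<in>B. P b)" if F: "F \<in> block_families X c (Suc j)" for F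
    proof -
      obtain b where "b \<in> F" "x \<in> b"
        using Union_block_family[OF Suc.prems F] x by blast
      then show ?thesis
        using F block_familiesD[OF F] by (auto simp: B_def P_def)
    qed
    then show ?thesis by (auto simp: P_def)
  qed
  also have "card \<dots> = (\<Sum>b\<in>B. card (P b))"
  proof (rule card_UN_disjoint[OF finB])
    show "\<forall>b\<in>B. finite (P b)"
      using finite_block_families[OF Suc.prems(1)] by (auto simp: P_def)
    have "b = b'" if "F \<in> P b" "F \<in> P b'" "b \<in> B" "b' \<in> B" for F b b'
    proof (rule ccontr)
      assume "b \<noteq> b'"
      then have "disjnt b b'"
        using that block_familiesD(5)[of F X c "Suc j"] by (auto simp: P_def pairwise_def)
      then show False
        using that by (auto simp: B_def disjnt_def)
    qed
    then show "\<forall>b\<in>B. \<forall>b'\<in>B. b \<noteq> b' \<longrightarrow> P b \<inter> P b' = {}" by blast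
  qed
  also have "\<dots> = card B * num_partitions c j"
    using cardP by simp
  also have "card B = (c * Suc j - 1) choose (c - 1)"
    using card_subsets_containing[OF Suc.prems(1) x \<open>c \<ge> 1\<close>] Suc.prems by (simp add: B_def)
  finally show ?case by simp
qed

lemma card_block_families_containing:
  assumes "c \<ge> 1" "finite X" "card X = c * k" and S: "S \<in> block_families X c s"
  shows "card {F \<in> block_families X c k. S \<subseteq> F} = num_partitions c (k - s)"
proof -
  have "s \<le> k"
    using block_families_size_le assms by blast
  have "card (X - \<Union>S) = c * (k - s)"
    by (rule card_Diff_Union_block_family[OF assms(2,3) S])
  then show ?thesis
    using bij_betw_same_card[OF bij_betw_block_families_containing[OF S \<open>c \<ge> 1\<close> \<open>s \<le> k\<close>]]
      card_block_families[of c "X - \<Union>S" "k - s"] assms by simp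
qed

text \<open>Any \<open>l\<close> blocks of a full partition will do, and a full partition exists
  because the count is positive.\<close>

lemma ex_block_family:
  assumes "c \<ge> 1" "finite X" "card X = c * k" "l \<le> k"
  shows "\<exists>A. A \<in> block_families X c l"
proof -
  have "num_partitions c j > 0" for j
    using \<open>c \<ge> 1\<close> by (induction j) auto
  then have "block_families X c k \<noteq> {}"
    using card_block_families[OF assms(1-3)] by (metis card.empty less_irrefl)
  then obtain F where F: "F \<in> block_families X c k" by blast
  then obtain A where "A \<subseteq> F" "card A = l"
    using obtain_subset_with_card_n[of l F] block_familiesD[OF F] assms by auto
  then show ?thesis
    using block_families_subset[OF F] by blast
qed

section \<open>Branching bounds and minimal covers\<close>

text \<open>The blocks of \<open>G\<close> that can be added to \<open>S\<close> are disjoint subsets of the \<open>c * (k - s)\<close>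
  points outside \<open>\<Union>S\<close>, so there are at most \<open>k - s\<close> of them.\<close>

lemma card_containing_le_step:
  assumes "c \<ge> 1" "finite X" "card X = c * k"
    and \<F>: "\<F> \<subseteq> block_families X c k" and G: "G \<in> block_families X c k"
    and meet: "\<And>F. F \<in> \<F> \<Longrightarrow> t \<le> card (F \<inter> G)"
    and S: "S \<in> block_families X c s" and small: "card (S \<inter> G) < t"
    and K: "\<And>b. insert b S \<in> block_families X c (Suc s) \<Longrightarrow>
              real (card {F \<in> \<F>. insert b S \<subseteq> F}) \<le> K" and "0 \<le> K"
  shows "real (card {F \<in> \<F>. S \<subseteq> F}) \<le> real (k - s) * K"
proof -
  have fin: "finite \<F>"
    using \<F> finite_block_families[OF assms(2)] finite_subset by blast
  define B where "B = {b \<in> G. b \<notin> S \<and> insert b S \<in> block_families X c (Suc s)}"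
  have finB: "finite B"
    using block_familiesD(1)[OF G] by (simp add: B_def)
  have disj: "b \<inter> \<Union>S = {}" if "b \<in> B" for b
    using that block_familiesD(5)[of "insert b S" X c "Suc s"]
    by (auto simp: B_def pairwise_insert disjnt_def)
  have "B \<in> block_families (X - \<Union>S) c (card B)"
    unfolding block_families_def
  proof (intro CollectI conjI ballI)
    show "pairwise disjnt B"
      using block_familiesD(5)[OF G] by (rule pairwise_subset) (auto simp: B_def)
    fix b assume b: "b \<in> B"
    then have "b \<in> G" by (simp add: B_def)
    then show "b \<subseteq> X - \<Union>S" "card b = c"
      using block_familiesD(3,4)[OF G, of b] disj[OF b] by auto
  qed (simp_all add: finB)
  moreover have "card (X - \<Union>S) = c * (k - s)"
    by (rule card_Diff_Union_block_family[OF assms(2,3) S])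
  ultimately have cardB: "card B \<le> k - s"
    using block_families_size_le[of "X - \<Union>S" c "k - s" B "card B"] assms by simp
  have sub: "{F \<in> \<F>. S \<subseteq> F} \<subseteq> (\<Union>b\<in>B. {F \<in> \<F>. insert b S \<subseteq> F})"
  proof clarify
    fix F assume F: "F \<in> \<F>" "S \<subseteq> F"
    have FX: "F \<in> block_families X c k" using F \<F> by blast
    \<comment> \<open>\<open>F\<close> shares at least \<open>t\<close> blocks with \<open>G\<close>
      and \<open>S\<close> shares fewer, so some common block of \<open>F\<close> and
      \<open>G\<close> lies outside \<open>S\<close>. Being in \<open>F\<close>, it is disjoint from
      the blocks of \<open>S\<close>.\<close>
    have "\<not> F \<inter> G \<subseteq> S \<inter> G"
      using meet[OF F(1)] small block_familiesD(1)[OF G] card_mono[of "S \<inter> G" "F \<inter> G"] by auto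
    then obtain b where b: "b \<in> F" "b \<in> G" "b \<notin> S" by blast
    have "insert b S \<in> block_families X c (card (insert b S))"
      using block_families_subset[OF FX, of "insert b S"] b F by auto
    then have "b \<in> B"
      using b block_familiesD(1,2)[OF S] by (simp add: B_def)
    then show "F \<in> (\<Union>b\<in>B. {F \<in> \<F>. insert b S \<subseteq> F})"
      using b F by auto
  qed
  have "card {F \<in> \<F>. S \<subseteq> F} \<le> card (\<Union>b\<in>B. {F \<in> \<F>. insert b S \<subseteq> F})"
    using sub finB fin by (intro card_mono) auto
  also have "\<dots> \<le> (\<Sum>b\<in>B. card {F \<in> \<F>. insert b S \<subseteq> F})"
    by (rule card_UN_le[OF finB])
  finally have "real (card {F \<in> \<F>. S \<subseteq> F}) \<le> (\<Sum>b\<in>B. real (card {F \<in> \<F>. insert b S \<subseteq> F}))"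
    unfolding of_nat_sum[symmetric] of_nat_le_iff .
  also have "\<dots> \<le> real (card B) * K"
    using K by (intro sum_bounded_above) (auto simp: B_def)
  also have "\<dots> \<le> real (k - s) * K"
    using cardB \<open>0 \<le> K\<close> by (intro mult_right_mono) auto
  finally show ?thesis .
qed

text \<open>As long as \<open>S\<close> has fewer than \<open>n\<close> blocks it is no cover, so a
  branching step applies and costs a factor \<open>k - s\<close>. The factors multiply to
  \<open>(k - s)! / (k - n)!\<close>, and \<open>n\<close> blocks lie in at most
  \<open>num_partitions c (k - n)\<close> partitions.\<close>

lemma card_containing_le_branching:
  assumes "c \<ge> 1" "finite X" "card X = c * k"
    and \<F>: "\<F> \<subseteq> block_families X c k" and \<G>: "\<G> \<subseteq> block_families X c k"
    and cross: "cross_intersecting t \<F> \<G>"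
    and no_cover: "\<And>S s. S \<in> block_families X c s \<Longrightarrow> s < n \<Longrightarrow> \<not> covers t \<G> S"
    and "n \<le> k" "S \<in> block_families X c s" "s \<le> n"
  shows "real (card {F \<in> \<F>. S \<subseteq> F}) \<le> fact (k - s) * partition_weight c (k - n)"
  using assms(9,10)
proof (induction "n - s" arbitrary: s S)
  case 0
  then have "s = n" by simp
  have "card {F \<in> \<F>. S \<subseteq> F} \<le> card {F \<in> block_families X c k. S \<subseteq> F}"
    using \<F> finite_block_families[OF assms(2)] by (intro card_mono) auto
  also have "\<dots> = num_partitions c (k - n)"
    using card_block_families_containing[OF assms(1-3) 0(2)] \<open>s = n\<close> by simp
  finally show ?case
    using \<open>s = n\<close> by (simp add: partition_weight_def)
next
  case (Suc d)
  then have "s < n" by simp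
  then obtain G where G: "G \<in> \<G>" "card (S \<inter> G) < t"
    using no_cover[OF Suc.prems(1)] by (auto simp: covers_def not_le)
  have "real (card {F \<in> \<F>. S \<subseteq> F}) \<le>
      real (k - s) * (fact (k - Suc s) * partition_weight c (k - n))"
  proof (rule card_containing_le_step[OF assms(1-3) \<F> _ _ Suc.prems(1) G(2)])
    show "G \<in> block_families X c k" using G \<G> by blast
    show "t \<le> card (F \<inter> G)" if "F \<in> \<F>" for F
      using cross that G by (auto simp: cross_intersecting_def)
    show "real (card {F \<in> \<F>. insert b S \<subseteq> F}) \<le> fact (k - Suc s) * partition_weight c (k - n)"
      if "insert b S \<in> block_families X c (Suc s)" for b
      using Suc.hyps(1)[OF _ that] Suc.hyps(2) \<open>s < n\<close> by simp
    show "0 \<le> fact (k - Suc s) * partition_weight c (k - n)"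
      by (simp add: partition_weight_def)
  qed
  also have "k - s = Suc (k - Suc s)" using \<open>s < n\<close> \<open>n \<le> k\<close> by simp
  then have "real (k - s) * (fact (k - Suc s) * partition_weight c (k - n)) =
      fact (k - s) * partition_weight c (k - n)"
    by simp
  finally show ?case .
qed

text \<open>Each member of \<open>\<F>\<close> contains one of the \<open>l choose t\<close> subsets
  of size \<open>t\<close> of the cover \<open>T\<close>; branching starts from each of these. The
  cover is one of \<open>\<F>\<close>, while \<open>n\<close> concerns covers of
  \<open>\<G>\<close>.\<close>

lemma card_le_branching:
  assumes "c \<ge> 1" "finite X" "card X = c * k"
    and \<F>: "\<F> \<subseteq> block_families X c k" and \<G>: "\<G> \<subseteq> block_families X c k"
    and cross: "cross_intersecting t \<F> \<G>"
    and no_cover: "\<And>S s. S \<in> block_families X c s \<Longrightarrow> s < n \<Longrightarrow> \<not> covers t \<G> S"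
    and "t \<le> n" "n \<le> k"
    and T: "T \<in> block_families X c l" "covers t \<F> T"
  shows "real (card \<F>) \<le> real (l choose t) * (fact (k - t) * partition_weight c (k - n))"
proof -
  define \<S> where "\<S> = {S. S \<subseteq> T \<and> card S = t}"
  have fin: "finite \<F>"
    using \<F> finite_block_families[OF assms(2)] finite_subset by blast
  have finS: "finite \<S>" and cardS: "card \<S> = l choose t"
    using block_familiesD(1,2)[OF T(1)] n_subsets[of T t] by (auto simp: \<S>_def)
  have "\<F> \<subseteq> (\<Union>S\<in>\<S>. {F \<in> \<F>. S \<subseteq> F})"
  proof
    fix F assume F: "F \<in> \<F>"
    then have "t \<le> card (T \<inter> F)"
      using T(2) by (simp add: covers_def)
    then obtain S where "S \<subseteq> T \<inter> F" "card S = t"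
      by (rule obtain_subset_with_card_n)
    then have "S \<in> \<S>" "F \<in> {F \<in> \<F>. S \<subseteq> F}"
      using F by (auto simp: \<S>_def)
    then show "F \<in> (\<Union>S\<in>\<S>. {F \<in> \<F>. S \<subseteq> F})"
      by (rule UN_I)
  qed
  then have "card \<F> \<le> card (\<Union>S\<in>\<S>. {F \<in> \<F>. S \<subseteq> F})"
    using finS fin by (intro card_mono) auto
  also have "\<dots> \<le> (\<Sum>S\<in>\<S>. card {F \<in> \<F>. S \<subseteq> F})"
    by (rule card_UN_le[OF finS])
  finally have "real (card \<F>) \<le> (\<Sum>S\<in>\<S>. real (card {F \<in> \<F>. S \<subseteq> F}))"
    unfolding of_nat_sum[symmetric] of_nat_le_iff .
  also have "\<dots> \<le> real (card \<S>) * (fact (k - t) * partition_weight c (k - n))"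
  proof (rule sum_bounded_above)
    fix S assume "S \<in> \<S>"
    then have "S \<in> block_families X c t"
      using block_families_subset[OF T(1)] by (auto simp: \<S>_def)
    from card_containing_le_branching[OF assms(1-3) \<F> \<G> cross no_cover \<open>n \<le> k\<close> this \<open>t \<le> n\<close>]
    show "real (card {F \<in> \<F>. S \<subseteq> F}) \<le> fact (k - t) * partition_weight c (k - n)" by simp
  qed
  finally show ?thesis by (simp add: cardS)
qed

text \<open>Any member of \<open>\<F>\<close> covers \<open>\<G>\<close>, so a least cover size
  exists and is at most \<open>k\<close>; a member of \<open>\<G>\<close> forces it to be at least
  \<open>t\<close>.\<close>

lemma obtain_min_cover:
  assumes "c \<ge> 1" "finite X" "card X = c * k"
    and \<F>: "\<F> \<subseteq> block_families X c k" "\<F> \<noteq> {}"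
    and \<G>: "\<G> \<subseteq> block_families X c k" "\<G> \<noteq> {}"
    and cross: "cross_intersecting t \<F> \<G>"
  obtains n T where "t \<le> n" "n \<le> k" "T \<in> block_families X c n" "covers t \<G> T"
    "\<And>S s. S \<in> block_families X c s \<Longrightarrow> s < n \<Longrightarrow> \<not> covers t \<G> S"
proof -
  define P where "P s \<longleftrightarrow> (\<exists>S\<in>block_families X c s. covers t \<G> S)" for s
  obtain F G where F: "F \<in> \<F>" and G: "G \<in> \<G>" using \<F> \<G> by blast
  have "P k"
    unfolding P_def covers_def using F \<F> cross
    by (intro bexI[of _ F]) (auto simp: cross_intersecting_def)
  then have "P (LEAST s. P s)" and le: "(LEAST s. P s) \<le> k"
    by (auto intro: LeastI Least_le)
  then obtain T where T: "T \<in> block_families X c (LEAST s. P s)" "covers t \<G> T"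
    by (auto simp: P_def)
  have "t \<le> card (T \<inter> G)" using T G by (auto simp: covers_def)
  also have "\<dots> \<le> card T" using block_familiesD(1)[OF T(1)] by (intro card_mono) auto
  finally have "t \<le> (LEAST s. P s)" using block_familiesD(2)[OF T(1)] by simp
  moreover have "\<not> covers t \<G> S" if "S \<in> block_families X c s" "s < (LEAST s. P s)" for S s
    using that not_less_Least[of s P] by (auto simp: P_def)
  ultimately show ?thesis using that le T by blast
qed

section \<open>Decay of the weighted bounds\<close>

lemma partition_weight_Suc:
  "partition_weight c (Suc j) =
    real ((c * Suc j - 1) choose (c - 1)) / real (Suc j) * partition_weight c j"
  by (simp add: partition_weight_def)

lemma partition_weight_pos: "c \<ge> 1 \<Longrightarrow> partition_weight c j > 0"
proof -
  assume "c \<ge> 1"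
  then have "num_partitions c j > 0" by (induction j) auto
  then show ?thesis by (simp add: partition_weight_def)
qed

text \<open>With \<open>u a\<close> the left-hand side of the claim, \<open>step\<close> says that \<open>u i < u (i - 1)\<close>. This can
  fail for \<open>i = m\<close>, where the number of completions no longer decreases; \<open>last\<close> therefore
  compares \<open>u m\<close> directly with \<open>u (m - 2)\<close>.\<close>

lemma choose_mult_partition_weight_less:
  assumes "c \<ge> 1" "m \<ge> 2"
    and step: "\<And>i. 1 \<le> i \<Longrightarrow> i < m \<Longrightarrow>
      (t + i) * (m - i + 1) < i * ((c * (m - i + 1) - 1) choose (c - 1))"
    and last: "2 * (t + m - 1) * (t + m) < (m - 1) * m * ((2 * c - 1) choose (c - 1))"
    and "1 \<le> a" "a \<le> m"
  shows "real ((t + a) choose t) * partition_weight c (m - a) < partition_weight c m"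
proof -
  define u where "u a = real ((t + a) choose t) * partition_weight c (m - a)" for a
  have u_pos: "u a > 0" for a
    using partition_weight_pos[OF \<open>c \<ge> 1\<close>] by (simp add: u_def)
  \<comment> \<open>The quotient \<open>u (Suc i) / u i\<close> without denominators: the binomial
    contributes \<open>(t + Suc i) / Suc i\<close>, the weight contributes \<open>m - i\<close> over
    \<open>(c * (m - i) - 1) choose (c - 1)\<close>.\<close>
  have ratio: "u (Suc i) * (real (Suc i) * real ((c * (m - i) - 1) choose (c - 1)))
      = u i * (real (t + Suc i) * real (m - i))" if "i < m" for i
  proof -
    obtain j where j: "m - i = Suc j" "m - Suc i = j"
      using \<open>i < m\<close> by (metis Suc_diff_Suc)
    have "Suc i * ((t + Suc i) choose t) = (t + Suc i) * ((t + i) choose t)"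
      using Suc_times_binomial_eq[of "t + i" i] binomial_symmetric[of t "t + i"]
        binomial_symmetric[of t "t + Suc i"] by (simp add: mult.commute)
    then have *: "real (Suc i) * real ((t + Suc i) choose t) = real (t + Suc i) * real ((t + i) choose t)"
      by (metis of_nat_mult)
    have w: "partition_weight c (Suc j) * real (Suc j) =
        real ((c * Suc j - 1) choose (c - 1)) * partition_weight c j"
      by (simp add: partition_weight_Suc del: of_nat_Suc)
    have "u (Suc i) * (real (Suc i) * real ((c * (m - i) - 1) choose (c - 1)))
        = (real (Suc i) * real ((t + Suc i) choose t)) *
          (real ((c * Suc j - 1) choose (c - 1)) * partition_weight c j)"
      unfolding u_def j by (simp only: ac_simps)
    also have "\<dots> = u i * (real (t + Suc i) * real (m - i))"
      unfolding u_def j w[symmetric] * by (simp only: ac_simps)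
    finally show ?thesis .
  qed
  have dec: "u (Suc i) < u i" if "Suc i < m" for i
  proof -
    have "m - Suc i + 1 = m - i" using that by simp
    then have "(t + Suc i) * (m - i) < Suc i * ((c * (m - i) - 1) choose (c - 1))"
      using step[of "Suc i"] that by simp
    then have "real (t + Suc i) * real (m - i) < real (Suc i) * real ((c * (m - i) - 1) choose (c - 1))"
      by (metis of_nat_less_iff of_nat_mult)
    then have "u i * (real (t + Suc i) * real (m - i)) <
        u i * (real (Suc i) * real ((c * (m - i) - 1) choose (c - 1)))"
      using u_pos by simp
    then have "u (Suc i) * (real (Suc i) * real ((c * (m - i) - 1) choose (c - 1))) <
        u i * (real (Suc i) * real ((c * (m - i) - 1) choose (c - 1)))"
      using ratio[of i] that by simp
    then show ?thesis
      by (rule mult_right_less_imp_less) simp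
  qed
  have chain: "u i \<le> u 0" if "i < m" for i
    using that
  proof (induction i)
    case (Suc i)
    then show ?case using dec[of i] by simp
  qed simp
  have "u a < u 0"
  proof (cases "a = m")
    case False
    then show ?thesis
      using chain[of "a - 1"] dec[of "a - 1"] \<open>1 \<le> a\<close> \<open>a \<le> m\<close> by fastforce
  next
    case True
    obtain p where p: "m = Suc (Suc p)"
      using \<open>m \<ge> 2\<close> by (metis add_2_eq_Suc le_Suc_ex)
    define B where "B = ((2 * c - 1) choose (c - 1))"
    \<comment> \<open>The binomials in the last two quotients are \<open>1\<close> and
      \<open>B\<close>. Multiplying these quotients gives exactly what \<open>last\<close>
      bounds.\<close>
    have r1: "u (Suc (Suc p)) * real (Suc (Suc p)) = u (Suc p) * real (t + Suc (Suc p))"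
      using ratio[of "Suc p"] p by simp
    have r2: "u (Suc p) * (real (Suc p) * real B) = u p * (real (t + Suc p) * 2)"
      using ratio[of p] p by (simp add: B_def mult.commute)
    have "u (Suc (Suc p)) * (real (Suc p) * real (Suc (Suc p)) * real B) =
        u p * (2 * real (t + Suc p) * real (t + Suc (Suc p)))"
      using r1 r2 by algebra
    moreover have "2 * (t + Suc p) * (t + Suc (Suc p)) < Suc p * Suc (Suc p) * B"
      using last by (simp add: p B_def)
    then have "2 * real (t + Suc p) * real (t + Suc (Suc p)) < real (Suc p) * real (Suc (Suc p)) * real B"
      by (metis of_nat_less_iff of_nat_mult of_nat_numeral)
    then have "u p * (2 * real (t + Suc p) * real (t + Suc (Suc p))) <
        u p * (real (Suc p) * real (Suc (Suc p)) * real B)"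
      using u_pos by simp
    ultimately have "u (Suc (Suc p)) * (real (Suc p) * real (Suc (Suc p)) * real B) <
        u p * (real (Suc p) * real (Suc (Suc p)) * real B)"
      by simp
    then have "u (Suc (Suc p)) < u p"
      by (rule mult_right_less_imp_less) simp
    then show ?thesis
      using chain[of p] p True by simp
  qed
  then show ?thesis by (simp add: u_def)
qed

section \<open>Binomial estimates under each of the two alternatives\<close>

text \<open>Reduces estimates to \<open>c = 3\<close>: by Pascal's rule raising both arguments by
  one does not decrease the binomial, and the upper argument grows by
  \<open>j \<ge> 1\<close>.\<close>

lemma choose_two_ge:
  assumes "c \<ge> 3" "j \<ge> 1"
  shows "(3 * j - 1) choose 2 \<le> (c * j - 1) choose (c - 1)"
  using assms(1)
proof (induction c rule: dec_induct)
  case (step c)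
  obtain d where d: "c = Suc d" using step by (cases c) auto
  have "(c * j - 1) choose (c - 1) \<le> Suc (c * j - 1) choose c"
    by (simp add: d)
  also have "\<dots> \<le> (Suc c * j - 1) choose c"
    using assms(2) step.hyps by (intro binomial_right_mono) auto
  finally show ?case using step by simp
qed simp

lemma weight_conditions_large_k:
  assumes "c \<ge> 3" "t \<ge> 1" "m \<ge> t + 2"
  shows "\<And>i. 1 \<le> i \<Longrightarrow> i < m \<Longrightarrow>
      (t + i) * (m - i + 1) < i * ((c * (m - i + 1) - 1) choose (c - 1))"
    and "2 * (t + m - 1) * (t + m) < (m - 1) * m * ((2 * c - 1) choose (c - 1))"
proof -
  fix i :: nat assume i: "1 \<le> i" "i < m"
  then obtain d where d: "m = i + Suc d" using less_imp_add_positive by (metis Suc_pred')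
  define e where "e = Suc d"
  have m: "m = i + e" and e: "e \<ge> 1" using d by (auto simp: e_def)
  \<comment> \<open>Here \<open>t \<le> i + e - 2\<close>, and \<open>e + i \<le> e * i + 1\<close>
    says that \<open>(e - 1) * (i - 1) \<ge> 0\<close>.\<close>
  have "t + i \<le> (e + 1) * i"
  proof -
    have "e + i \<le> e * i + 1"
      using e i by (cases e; cases i) auto
    then show ?thesis using assms m by simp
  qed
  then have "(t + i) * (e + 1) \<le> i * ((e + 1) * (e + 1))"
    by (metis mult.assoc mult.commute mult_le_mono1)
  also have "(e + 1) * (e + 1) < (3 * (e + 1) - 1) choose 2"
  proof -
    have "2 * ((3 * (e + 1) - 1) choose 2) = (3 * e + 2) * (3 * e + 1)"
      by (simp add: choose_two)
    moreover have "2 * ((e + 1) * (e + 1)) < (3 * e + 2) * (3 * e + 1)"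
      using e by (simp add: algebra_simps)
    ultimately show ?thesis by linarith
  qed
  then have "i * ((e + 1) * (e + 1)) < i * ((3 * (e + 1) - 1) choose 2)"
    using i by (intro mult_strict_left_mono) auto
  also have "\<dots> \<le> i * ((c * (e + 1) - 1) choose (c - 1))"
    using choose_two_ge[OF assms(1), of "e + 1"] by simp
  finally show "(t + i) * (m - i + 1) < i * ((c * (m - i + 1) - 1) choose (c - 1))"
    by (simp add: m)
next
  \<comment> \<open>\<open>10\<close> is \<open>5 choose 2\<close>, the case \<open>c = 3\<close>.
    It suffices because \<open>t \<le> m - 2\<close> bounds the left-hand side by
    \<open>8 * ((m - 1) * m)\<close>.\<close>
  have "10 \<le> (2 * c - 1) choose (c - 1)"
    using choose_two_ge[OF assms(1), of 2] by (simp add: choose_two mult.commute)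
  have "(t + m - 1) * (t + m) \<le> (2 * (m - 1)) * (2 * m)"
    using assms by (intro mult_le_mono) auto
  then have "2 * (t + m - 1) * (t + m) \<le> 8 * ((m - 1) * m)"
    by (simp add: ac_simps)
  also have "\<dots> < (m - 1) * m * 10"
    using assms by simp
  also have "\<dots> \<le> (m - 1) * m * ((2 * c - 1) choose (c - 1))"
    using \<open>10 \<le> _\<close> by (intro mult_le_mono2)
  finally show "2 * (t + m - 1) * (t + m) < (m - 1) * m * ((2 * c - 1) choose (c - 1))" .
qed

text \<open>By Pascal's rule and symmetry the binomial at least doubles when \<open>c\<close> grows
  by one, starting from \<open>10\<close> at \<open>c = 3\<close>. The factor \<open>6\<close> is
  chosen for \<open>(t + 1) * (t + 2) \<le> 6 * t ^ 2\<close>.\<close>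

lemma power_two_less_choose:
  assumes "c \<ge> 3"
  shows "6 * 2 ^ (c - 3) < (2 * c - 1) choose (c - 1)"
  using assms
proof (induction c rule: dec_induct)
  case base
  show ?case by (simp add: choose_two numeral_eq_Suc)
next
  case (step c)
  obtain d where d: "c = Suc (Suc (Suc d))"
    using step.hyps by (metis Suc_le_D numeral_3_eq_3 Suc_le_mono)
  have "2 * ((2 * c - 1) choose (c - 1)) \<le> (2 * Suc c - 1) choose (Suc c - 1)"
    using binomial_symmetric[of c "2 * c - 1"] by (simp add: d)
  then show ?case using step by (simp add: d)
qed

text \<open>Both conditions come down to \<open>(t + 1) * (t + 2) < B\<close>. For the first,
  \<open>t + i \<le> i * (t + 1)\<close> leaves a bound linear in
  \<open>j = m - i + 1\<close>.\<close>

lemma weight_conditions_large_c: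
  assumes "c \<ge> 3" "t \<ge> 1" "m \<ge> 2" "t ^ 2 \<le> 2 ^ (c - 3)"
  shows "\<And>i. 1 \<le> i \<Longrightarrow> i < m \<Longrightarrow>
      (t + i) * (m - i + 1) < i * ((c * (m - i + 1) - 1) choose (c - 1))"
    and "2 * (t + m - 1) * (t + m) < (m - 1) * m * ((2 * c - 1) choose (c - 1))"
proof -
  define B where "B = ((2 * c - 1) choose (c - 1))"
  have "(t + 1) * (t + 2) \<le> (2 * t) * (3 * t)"
    using assms by (intro mult_le_mono) auto
  also have "\<dots> = 6 * t ^ 2" by (simp add: power2_eq_square)
  also have "\<dots> \<le> 6 * 2 ^ (c - 3)" using assms by simp
  also have "\<dots> < B" using power_two_less_choose[OF assms(1)] by (simp add: B_def)
  finally have B: "(t + 1) * (t + 2) < B" .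
  \<comment> \<open>This bounds the increment in the induction on \<open>j\<close> below. Absorption
    expresses the binomial through \<open>B\<close>, and \<open>c \<ge> 3\<close> gives
    \<open>c + 1 \<le> 2 * (c - 1)\<close>.\<close>
  have incr: "t + 1 \<le> (2 * c - 1) choose (c - 2)"
  proof -
    have "(c + 1) * ((2 * c - 1) choose (c - 2)) = (c - 1) * B"
      using binomial_absorb_comp[of "2 * c - 1" "c - 2"] binomial_absorption[of "c - 2" "2 * c - 1"]
        \<open>c \<ge> 3\<close> by (simp add: B_def Suc_diff_Suc numeral_2_eq_2)
    moreover have "(c + 1) * (t + 1) \<le> (c - 1) * B"
    proof -
      have "(c + 1) * (t + 1) \<le> (2 * (c - 1)) * (t + 1)"
        using assms by (intro mult_le_mono1) simp
      also have "\<dots> \<le> (c - 1) * ((t + 1) * (t + 2))" by simp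
      also have "\<dots> \<le> (c - 1) * B" using B by (intro mult_le_mono2) simp
      finally show ?thesis .
    qed
    ultimately have "(c + 1) * (t + 1) \<le> (c + 1) * ((2 * c - 1) choose (c - 2))" by simp
    then show ?thesis by (simp only: mult_le_cancel1)
  qed
  have lin: "(t + 1) * j < (c * j - 1) choose (c - 1)" if "j \<ge> 2" for j
    using that
  proof (induction j rule: dec_induct)
    case base
    have "(t + 1) * 2 \<le> (t + 1) * (t + 2)" by simp
    then show ?case using B by (simp add: B_def mult.commute)
  next
    case (step j)
    obtain d where d: "c = Suc (Suc d)"
      using assms(1) by (metis add_2_eq_Suc le_Suc_ex numeral_3_eq_3 numeral_2_eq_2 add_Suc)
    have ge: "2 * c \<le> c * j" using step.hyps by simp
    have "(t + 1) * Suc j < ((c * j - 1) choose (c - 1)) + ((2 * c - 1) choose (c - 2))"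
      using step.IH incr by simp
    also have "\<dots> \<le> ((c * j - 1) choose (c - 1)) + ((c * j - 1) choose (c - 2))"
      using ge by (intro add_left_mono binomial_right_mono diff_le_mono)
    also have "\<dots> = Suc (c * j - 1) choose (c - 1)"
      by (simp add: d)
    also have "\<dots> \<le> (c * Suc j - 1) choose (c - 1)"
      using assms(1) by (intro binomial_right_mono) auto
    finally show ?case .
  qed
  show "(t + i) * (m - i + 1) < i * ((c * (m - i + 1) - 1) choose (c - 1))"
    if i: "1 \<le> i" "i < m" for i
  proof -
    have "t + i \<le> i * (t + 1)" using i by (cases i) auto
    then have "(t + i) * (m - i + 1) \<le> i * (t + 1) * (m - i + 1)"
      by (rule mult_le_mono1)
    also have "\<dots> = i * ((t + 1) * (m - i + 1))" by (simp only: mult.assoc)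
    also have "\<dots> < i * ((c * (m - i + 1) - 1) choose (c - 1))"
      using lin[of "m - i + 1"] i by (intro mult_strict_left_mono) auto
    finally show ?thesis .
  qed
  obtain p where p: "m = p + 2" using assms(3) by (metis le_Suc_ex add.commute)
  have "2 * (t + m - 1) * (t + m) = (t + m - 1) * (2 * (t + m))" by simp
  also have "\<dots> \<le> ((m - 1) * (t + 1)) * (m * (t + 2))"
    by (rule mult_le_mono) (auto simp: p algebra_simps)
  also have "\<dots> = (m - 1) * m * ((t + 1) * (t + 2))" by (simp only: ac_simps)
  also have "\<dots> < (m - 1) * m * B"
    using B p by (intro mult_strict_left_mono) auto
  finally show "2 * (t + m - 1) * (t + m) < (m - 1) * m * ((2 * c - 1) choose (c - 1))"
    by (simp add: B_def)
qed

text \<open>Exponentiates the logarithmic alternative.\<close>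

lemma square_le_power_of_log:
  assumes "c \<ge> 3" "t \<ge> 1" "real c \<ge> 3 + 2 * log 2 (real t)"
  shows "t ^ 2 \<le> 2 ^ (c - 3)"
proof -
  have "log 2 (real t ^ 2) \<le> real (c - 3)"
    using assms by (simp add: log_nat_power of_nat_diff)
  then have "real t ^ 2 \<le> 2 powr real (c - 3)"
    using assms by (subst (asm) log_le_iff) auto
  then have "real (t ^ 2) \<le> real (2 ^ (c - 3))"
    by (simp add: powr_realpow)
  then show ?thesis by (simp only: of_nat_le_iff)
qed

section \<open>Extremal pairs: combining the bounds, then equality\<close>

theorem theorem1p1:
  fixes c k t :: nat and \<F> \<G> :: "nat set set set"
  assumes "c \<ge> 3" and "t \<ge> 1" and "k \<ge> t + 2"
    and "\<F> \<subseteq> block_families {1..c * k} c k"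
    and "\<G> \<subseteq> block_families {1..c * k} c k"
    and "cross_intersecting t \<F> \<G>"
    and "\<And>\<F>' \<G>'. \<lbrakk>\<F>' \<subseteq> block_families {1..c * k} c k;
            \<G>' \<subseteq> block_families {1..c * k} c k; cross_intersecting t \<F>' \<G>'\<rbrakk>
          \<Longrightarrow> card \<F>' * card \<G>' \<le> card \<F> * card \<G>"
    and "real c \<ge> 3 + 2 * log 2 (real t) \<or> k \<ge> 2 * t + 2"
  shows "\<exists>T \<in> block_families {1..c * k} c t.
           \<F> = {F \<in> block_families {1..c * k} c k. T \<subseteq> F} \<and>
           \<G> = {F \<in> block_families {1..c * k} c k. T \<subseteq> F}"
proof -
  define X where "X = {1..c * k}"
  define m where "m = k - t"
  define w where "w = partition_weight c"
  define N where "N = num_partitions c m"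
  have c: "c \<ge> 1" and X: "finite X" "card X = c * k" and m: "m \<ge> 2"
    using assms by (auto simp: X_def m_def)
  note \<F> = assms(4)[folded X_def] and \<G> = assms(5)[folded X_def] and cross = assms(6)
  have cross': "cross_intersecting t \<G> \<F>"
    using cross unfolding cross_intersecting_def by (metis Int_commute)
  have fin: "finite \<F>" "finite \<G>"
    using \<F> \<G> finite_block_families[OF X(1)] finite_subset by blast+
  \<comment> \<open>The two alternatives of the hypothesis enter here.\<close>
  have less: "real ((t + a) choose t) * w (m - a) < w m" if "1 \<le> a" "a \<le> m" for a
  proof (cases "k \<ge> 2 * t + 2")
    case True
    then have "m \<ge> t + 2" by (simp add: m_def)
    from choose_mult_partition_weight_less[OF c m weight_conditions_large_k[OF assms(1,2) this] that]
    show ?thesis by (simp add: w_def)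
  next
    case False
    then have "t ^ 2 \<le> 2 ^ (c - 3)"
      using square_le_power_of_log assms by blast
    from choose_mult_partition_weight_less[OF c m weight_conditions_large_c[OF assms(1,2) m this] that]
    show ?thesis by (simp add: w_def)
  qed
  have le: "real ((t + a) choose t) * w (m - a) \<le> w m" if "a \<le> m" for a
    using less[of a] that by (cases "a = 0") auto
  have wpos: "w j > 0" for j
    using partition_weight_pos[OF c] by (simp add: w_def)
  have N: "fact m * w m = real N"
    by (simp add: w_def N_def partition_weight_def)
  have Npos: "real N > 0"
    using wpos by (simp flip: N)
  \<comment> \<open>The competitor is the pair \<open>\<H>\<close>, \<open>\<H>\<close> of all
    partitions through one fixed \<open>T\<close>.\<close>
  have lower: "N * N \<le> card \<F> * card \<G>"
  proof -
    obtain T where T: "T \<in> block_families X c t"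
      using ex_block_family[OF c X, of t] assms(3) by auto
    define \<H> where "\<H> = {F \<in> block_families X c k. T \<subseteq> F}"
    have "cross_intersecting t \<H> \<H>"
      unfolding cross_intersecting_def
    proof (intro ballI)
      fix A B assume AB: "A \<in> \<H>" "B \<in> \<H>"
      then have "card T \<le> card (A \<inter> B)"
        by (intro card_mono) (auto simp: \<H>_def dest: block_familiesD(1))
      then show "t \<le> card (A \<inter> B)" using block_familiesD(2)[OF T] by simp
    qed
    moreover have "card \<H> = N"
      using card_block_families_containing[OF c X T] by (simp add: \<H>_def N_def m_def)
    moreover have "\<H> \<subseteq> block_families {1..c * k} c k"
      by (auto simp: \<H>_def X_def)
    ultimately show ?thesis using assms(7)[of \<H> \<H>] by simp
  qed
  then have ne: "\<F> \<noteq> {}" "\<G> \<noteq> {}"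
    using Npos by auto
  obtain n T where n: "t \<le> n" "n \<le> k" and T: "T \<in> block_families X c n" "covers t \<G> T"
    and min: "\<And>S s. S \<in> block_families X c s \<Longrightarrow> s < n \<Longrightarrow> \<not> covers t \<G> S"
    using obtain_min_cover[OF c X \<F> ne(1) \<G> ne(2) cross] by metis
  obtain n' T' where n': "t \<le> n'" "n' \<le> k" and T': "T' \<in> block_families X c n'" "covers t \<F> T'"
    and min': "\<And>S s. S \<in> block_families X c s \<Longrightarrow> s < n' \<Longrightarrow> \<not> covers t \<F> S"
    using obtain_min_cover[OF c X \<G> ne(2) \<F> ne(1) cross'] by metis
  define a where "a = n - t"
  define b where "b = n' - t"
  have ab: "a \<le> m" "b \<le> m" "n = t + a" "n' = t + b" "k - n = m - a" "k - n' = m - b"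
    using n n' by (auto simp: a_def b_def m_def)
  have bF: "real (card \<F>) \<le> real ((t + b) choose t) * (fact m * w (m - a))"
    using card_le_branching[OF c X \<F> \<G> cross min n T'] ab by (simp add: m_def w_def)
  have bG: "real (card \<G>) \<le> real ((t + a) choose t) * (fact m * w (m - b))"
    using card_le_branching[OF c X \<G> \<F> cross' min' n' T] ab by (simp add: m_def w_def)
  have "a = 0 \<and> b = 0"
  proof (rule ccontr)
    assume *: "\<not> (a = 0 \<and> b = 0)"
    \<comment> \<open>Regrouping: \<open>p\<close> takes its binomial from the bound on
      \<open>\<G>\<close> and its weight from the bound on \<open>\<F>\<close>, so it depends on
      \<open>a\<close> alone; likewise \<open>q\<close> on \<open>b\<close>.\<close>
    define p where "p = real ((t + a) choose t) * w (m - a)"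
    define q where "q = real ((t + b) choose t) * w (m - b)"
    have pq: "0 < p" "0 < q" "p \<le> w m" "q \<le> w m"
      using wpos le ab by (auto simp: p_def q_def)
    have "p < w m \<or> q < w m"
      using * less ab by (auto simp: p_def q_def)
    then have "p * q < w m * w m"
      using pq mult_strict_mono' mult_less_le_imp_less[of p "w m" q "w m"]
        mult_le_less_imp_less[of p "w m" q "w m"] by auto
    have "real (card \<F>) * real (card \<G>) \<le>
        (real ((t + b) choose t) * (fact m * w (m - a))) *
        (real ((t + a) choose t) * (fact m * w (m - b)))"
      using bF bG by (intro mult_mono) (auto intro: mult_nonneg_nonneg less_imp_le[OF wpos])
    also have "\<dots> = (fact m * fact m) * (p * q)"
      by (simp add: p_def q_def)
    also have "\<dots> < (fact m * fact m) * (w m * w m)"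
      using \<open>p * q < w m * w m\<close> by (intro mult_strict_left_mono) auto
    also have "\<dots> = real N * real N"
      by (simp flip: N)
    finally have "card \<F> * card \<G> < N * N"
      by (metis of_nat_less_iff of_nat_mult)
    then show False using lower by simp
  qed
  then have cards: "card \<F> \<le> N" "card \<G> \<le> N" and "n = t"
    using bF bG ab by (auto simp: N)
  have T_fam: "T \<in> block_families X c t" using T \<open>n = t\<close> by simp
  \<comment> \<open>Both cardinalities are at most \<open>N\<close> and their product is at least
    \<open>N * N\<close>.\<close>
  have eqN: "card \<F> = N" "card \<G> = N"
  proof -
    have "card \<F> * card \<G> \<le> card \<F> * N" "card \<F> * card \<G> \<le> N * card \<G>"
      using cards by simp_all
    then have "N * N \<le> card \<F> * N" "N * N \<le> N * card \<G>"
      using lower by linarith+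
    then show "card \<F> = N" "card \<G> = N" using cards Npos by auto
  qed
  have subset_of_cover: "T \<subseteq> F" if "t \<le> card (T \<inter> F)" for F
  proof -
    have "T \<inter> F = T"
      using that block_familiesD(1,2)[OF T_fam] by (intro card_seteq) auto
    then show ?thesis by blast
  qed
  have TG: "T \<subseteq> G" if "G \<in> \<G>" for G
    using that T(2) subset_of_cover by (auto simp: covers_def)
  \<comment> \<open>\<open>T\<close> is only known to cover \<open>\<G>\<close>. If some
    \<open>F\<close> missed a block of \<open>T\<close>, one branching step from \<open>T\<close>
    against \<open>F\<close> would bound \<open>card \<G>\<close> by
    \<open>fact m * w (m - 1)\<close>, which is less than \<open>N\<close>.\<close>
  have TF: "T \<subseteq> F" if F: "F \<in> \<F>" for F
  proof (rule ccontr)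
    assume "\<not> T \<subseteq> F"
    then have "card (T \<inter> F) < t" using subset_of_cover not_le by blast
    have "real (card {G \<in> \<G>. T \<subseteq> G}) \<le> real (k - t) * real (num_partitions c (k - Suc t))"
    proof (rule card_containing_le_step[OF c X \<G> _ _ T_fam \<open>card (T \<inter> F) < t\<close>])
      show "F \<in> block_families X c k" using F \<F> by blast
      show "t \<le> card (G \<inter> F)" if "G \<in> \<G>" for G
        using that F cross' by (auto simp: cross_intersecting_def)
      fix b assume "insert b T \<in> block_families X c (Suc t)"
      from card_block_families_containing[OF c X this]
      have "card {G \<in> block_families X c k. insert b T \<subseteq> G} = num_partitions c (k - Suc t)" .
      moreover have "card {G \<in> \<G>. insert b T \<subseteq> G} \<le> card {G \<in> block_families X c k. insert b T \<subseteq> G}"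
        using \<G> finite_block_families[OF X(1)] by (intro card_mono) auto
      ultimately show "real (card {G \<in> \<G>. insert b T \<subseteq> G}) \<le> real (num_partitions c (k - Suc t))"
        by simp
    qed simp
    moreover have "{G \<in> \<G>. T \<subseteq> G} = \<G>" using TG by auto
    moreover have "real (k - t) * real (num_partitions c (k - Suc t)) = fact m * w (m - 1)"
    proof -
      obtain j where "m = Suc j" using m by (cases m) auto
      moreover from this have "k - Suc t = j" "k - t = Suc j" by (auto simp: m_def)
      ultimately show ?thesis by (simp add: w_def partition_weight_def)
    qed
    \<comment> \<open>The case \<open>a = 1\<close> of \<open>less\<close>, with the binomial
      bounded below by \<open>1\<close>.\<close>
    moreover have "1 * w (m - 1) \<le> real ((t + 1) choose t) * w (m - 1)"
      using wpos[of "m - 1"] by (intro mult_right_mono) auto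
    then have "w (m - 1) < w m"
      using less[of 1] m by simp
    then have "fact m * w (m - 1) < fact m * w m" by simp
    ultimately show False using eqN N by simp
  qed
  have cardT: "card {F \<in> block_families X c k. T \<subseteq> F} = N"
    using card_block_families_containing[OF c X T_fam] by (simp add: N_def m_def)
  have eq: "\<H> = {F \<in> block_families X c k. T \<subseteq> F}"
    if "\<H> \<subseteq> block_families X c k" "\<And>F. F \<in> \<H> \<Longrightarrow> T \<subseteq> F" "card \<H> = N" for \<H>
    using that cardT finite_block_families[OF X(1), of c k] by (intro card_subset_eq) auto
  have "\<F> = {F \<in> block_families X c k. T \<subseteq> F}" "\<G> = {F \<in> block_families X c k. T \<subseteq> F}"
    using eq[OF \<F> TF eqN(1)] eq[OF \<G> TG eqN(2)] by simp_all
  then show ?thesis using T_fam unfolding X_def by blast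
qed

end
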